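(* Let $G$ be a finite group, let $\mathcal D$ be a collection of subgroups of $G$, and let $\mu$ be the Möbius function of the finite poset $\mathcal D\cap\operatorname{NS}(G)$ ordered by inclusion. For every $x\in\Omega(G,\mathcal D)$ and $N\in\mathcal D\cap\operatorname{NS}(G)$, $$c_N(x)=\sum_{\substack{M\in\mathcal D\cap\operatorname{NS}(G)\\ N\leq M}}\mu(N,M)\,s_M(x).$$ Thus the family of core coefficients $(c_N(x))_N$ and the family of cumulative core coefficients $(s_N(x))_N$ determine one another uniquely.
   Context: For a finite group $G$, $\Omega(G)$ is the Burnside ring (Grothendieck ring of finite $G$-sets under disjoint union and Cartesian product), with $\mathbb Z$-basis $[G/H]$, $(H)$ running over the conjugacy classes of subgroups of $G$. $\operatorname{NS}(G)$ is the set of normal subgroups of $G$. A collection $\mathcal D$ of $G$ is a set of subgroups of $G$ containing $G$ and closed under $G$-conjugation and under pairwise intersection; $\mathcal D^c$ is the set of $G$-conjugacy classes $(H)$ with $H\in\mathcal D$. The partial Burnside ring is the unital subring $\Omega(G,\mathcal D)=\bigoplus_{(H)\in\mathcal D^c}\mathbb Z[G/H]$ of $\Omega(G)$. With $\operatorname{core}_G(H)=\bigcap_{g\in G}gHg^{-1}$ (which lies in $\mathcal D\cap\operatorname{NS}(G)$ if $H\in\mathcal D$), for $x=\sum_{(H)\in\mathcal D^c}a_H[G/H]$ and $N\in\mathcal D\cap\operatorname{NS}(G)$ put $c_N(x)=\sum_{(H)\in\mathcal D^c,\ \operatorname{core}_G(H)=N}a_H$ (core coefficient) and $s_N(x)=\sum_{M\in\mathcal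 D\cap\operatorname{NS}(G),\ N\le M}c_M(x)$ (cumulative core coefficient). *)

theory Defs
  imports "HOL-Algebra.Group_Action" "HOL-Algebra.Left_Coset" "HOL-Algebra.Ring"
begin

subsection \<open>Finite \<open>G\<close>-sets\<close>

type_synonym ('a, 'e) gset = "'e set \<times> ('a \<Rightarrow> 'e \<Rightarrow> 'e)"

definition finite_gset :: "('a, 'm) monoid_scheme \<Rightarrow> ('a, 'e) gset \<Rightarrow> bool" where
  "finite_gset G X \<longleftrightarrow> finite (fst X) \<and> group_action G (fst X) (snd X)"

definition gset_iso :: "('a, 'm) monoid_scheme \<Rightarrow> ('a, 'e) gset \<Rightarrow> ('a, 'f) gset \<Rightarrow> bool" where
  "gset_iso G X Y \<longleftrightarrow> (\<exists>f. bij_betw f (fst X) (fst Y) \<and>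
     (\<forall>g\<in>carrier G. \<forall>x\<in>fst X. f (snd X g x) = snd Y g (f x)))"

text \<open>The actions are restricted to the underlying sets because \<^locale>\<open>group_action\<close> works
  with extensional bijections.\<close>

definition gset_sum :: "('a, 'e) gset \<Rightarrow> ('a, 'f) gset \<Rightarrow> ('a, 'e + 'f) gset" where
  "gset_sum X Y = (fst X <+> fst Y, \<lambda>g. \<lambda>z\<in>fst X <+> fst Y. map_sum (snd X g) (snd Y g) z)"

definition gset_prod :: "('a, 'e) gset \<Rightarrow> ('a, 'f) gset \<Rightarrow> ('a, 'e \<times> 'f) gset" where
  "gset_prod X Y = (fst X \<times> fst Y, \<lambda>g. \<lambda>z\<in>fst X \<times> fst Y. map_prod (snd X g) (snd Y g) z)"

definition gset_empty :: "('a, nat) gset" where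
  "gset_empty = ({}, \<lambda>g. \<lambda>x\<in>{}. x)"

definition gset_point :: "('a, unit) gset" where
  "gset_point = ({()}, \<lambda>g. \<lambda>x\<in>{()}. x)"

definition gset_cosets :: "('a, 'm) monoid_scheme \<Rightarrow> 'a set \<Rightarrow> ('a, 'a set) gset" where
  "gset_cosets G H = (lcosets\<^bsub>G\<^esub> H, \<lambda>g. \<lambda>C\<in>lcosets\<^bsub>G\<^esub> H. g <#\<^bsub>G\<^esub> C)"


subsection \<open>The Burnside ring\<close>

text \<open>\<open>burnside_diff G X Y\<close> is the element \<open>[X] - [Y]\<close> of the Grothendieck ring: the class of the
  pair \<open>(X, Y)\<close> under \<open>(X, Y) \<sim> (X', Y') \<longleftrightarrow> X + Y' + Z \<cong> X' + Y + Z\<close> for some \<open>Z\<close>.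
  The members of a class are \<open>G\<close>-sets on subsets of \<^typ>\<open>nat\<close>, which is no restriction as every
  finite \<open>G\<close>-set is isomorphic to one of those; \<open>X\<close> and \<open>Y\<close> themselves may live on any types.\<close>

type_synonym 'a burnside = "(('a, nat) gset \<times> ('a, nat) gset) set"

definition burnside_diff ::
    "('a, 'm) monoid_scheme \<Rightarrow> ('a, 'e) gset \<Rightarrow> ('a, 'f) gset \<Rightarrow> 'a burnside" where
  "burnside_diff G X Y = {(X', Y'). finite_gset G X' \<and> finite_gset G Y' \<and>
     (\<exists>Z :: ('a, nat) gset. finite_gset G Z \<and>
        gset_iso G (gset_sum (gset_sum X Y') Z) (gset_sum (gset_sum X' Y) Z))}"

definition burnside_class :: "('a, 'm) monoid_scheme \<Rightarrow> ('a, 'e) gset \<Rightarrow> 'a burnside" where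
  "burnside_class G X = burnside_diff G X gset_empty"

text \<open>Sum and product are defined on representatives: the unions below are over families
  of equal sets.\<close>

definition burnside_ring :: "('a, 'm) monoid_scheme \<Rightarrow> 'a burnside ring" where
  "burnside_ring G =
    \<lparr>carrier = {burnside_diff G X Y |(X :: ('a, nat) gset) (Y :: ('a, nat) gset).
        finite_gset G X \<and> finite_gset G Y},
     mult = (\<lambda>A B. \<Union>(X, X')\<in>A. \<Union>(Y, Y')\<in>B.
        burnside_diff G (gset_sum (gset_prod X Y) (gset_prod X' Y'))
                        (gset_sum (gset_prod X Y') (gset_prod X' Y))),
     one = burnside_class G gset_point,
     zero = burnside_class G gset_empty,
     add = (\<lambda>A B. \<Union>(X, X')\<in>A. \<Union>(Y, Y')\<in>B.
        burnside_diff G (gset_sum X Y) (gset_sum X' Y'))\<rparr>"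


subsection \<open>Collections and partial Burnside rings\<close>

definition conj_subgroup :: "('a, 'm) monoid_scheme \<Rightarrow> 'a \<Rightarrow> 'a set \<Rightarrow> 'a set" where
  "conj_subgroup G g H = g <#\<^bsub>G\<^esub> H #>\<^bsub>G\<^esub> inv\<^bsub>G\<^esub> g"

definition conj_class :: "('a, 'm) monoid_scheme \<Rightarrow> 'a set \<Rightarrow> 'a set set" where
  "conj_class G H = {conj_subgroup G g H | g. g \<in> carrier G}"

definition conj_classes :: "('a, 'm) monoid_scheme \<Rightarrow> 'a set set \<Rightarrow> 'a set set set" where
  "conj_classes G D = {conj_class G H | H. H \<in> D}"

definition subgroup_collection :: "('a, 'm) monoid_scheme \<Rightarrow> 'a set set \<Rightarrow> bool" where
  "subgroup_collection G D \<longleftrightarrow>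
     (\<forall>H\<in>D. subgroup H G) \<and>
     carrier G \<in> D \<and>
     (\<forall>H\<in>D. \<forall>g\<in>carrier G. conj_subgroup G g H \<in> D) \<and>
     (\<forall>H\<in>D. \<forall>K\<in>D. H \<inter> K \<in> D)"

definition normal_subgroups :: "('a, 'm) monoid_scheme \<Rightarrow> 'a set set" where
  "normal_subgroups G = {N. N \<lhd> G}"

definition core :: "('a, 'm) monoid_scheme \<Rightarrow> 'a set \<Rightarrow> 'a set" where
  "core G H = (\<Inter>g\<in>carrier G. conj_subgroup G g H)"

text \<open>The basis element \<open>[G/H]\<close> depends only on the conjugacy class \<open>C\<close> of \<open>H\<close>.\<close>

definition burnside_basis :: "('a, 'm) monoid_scheme \<Rightarrow> 'a set set \<Rightarrow> 'a burnside" where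
  "burnside_basis G C = burnside_class G (gset_cosets G (SOME H. H \<in> C))"

definition burnside_combination ::
    "('a, 'm) monoid_scheme \<Rightarrow> 'a set set \<Rightarrow> ('a set set \<Rightarrow> int) \<Rightarrow> 'a burnside" where
  "burnside_combination G D a =
     (\<Oplus>\<^bsub>burnside_ring G\<^esub>C\<in>conj_classes G D. [a C] \<cdot>\<^bsub>burnside_ring G\<^esub> burnside_basis G C)"

definition partial_burnside_ring ::
    "('a, 'm) monoid_scheme \<Rightarrow> 'a set set \<Rightarrow> 'a burnside ring" where
  "partial_burnside_ring G D =
     (burnside_ring G)\<lparr>carrier := {burnside_combination G D a | a. True}\<rparr>"

text \<open>The family \<open>(a\<^sub>H)\<close> of coefficients of \<open>x\<close>, indexed by conjugacy classes and set to \<open>0\<close>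
  outside those of \<open>D\<close>. It is unique because the \<open>[G/H]\<close> form a \<open>\<int>\<close>-basis.\<close>

definition burnside_coeff ::
    "('a, 'm) monoid_scheme \<Rightarrow> 'a set set \<Rightarrow> 'a burnside \<Rightarrow> 'a set set \<Rightarrow> int" where
  "burnside_coeff G D x =
     (THE a. (\<forall>C. C \<notin> conj_classes G D \<longrightarrow> a C = 0) \<and> x = burnside_combination G D a)"

definition core_coeff ::
    "('a, 'm) monoid_scheme \<Rightarrow> 'a set set \<Rightarrow> 'a burnside \<Rightarrow> 'a set \<Rightarrow> int" where
  "core_coeff G D x N =
     (\<Sum>C\<in>{conj_class G H | H. H \<in> D \<and> core G H = N}. burnside_coeff G D x C)"

definition cumulative_core_coeff ::
    "('a, 'm) monoid_scheme \<Rightarrow> 'a set set \<Rightarrow> 'a burnside \<Rightarrow> 'a set \<Rightarrow> int" where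
  "cumulative_core_coeff G D x N =
     (\<Sum>M\<in>{M \<in> D \<inter> normal_subgroups G. N \<subseteq> M}. core_coeff G D x M)"


subsection \<open>The Moebius function of a finite poset\<close>

function poset_mobius :: "'b::order set \<Rightarrow> 'b \<Rightarrow> 'b \<Rightarrow> int" where
  "poset_mobius P x y =
     (if finite P \<and> x \<in> P \<and> y \<in> P \<and> x \<le> y
      then if x = y then 1 else - (\<Sum>z\<in>{z \<in> P. x \<le> z \<and> z < y}. poset_mobius P x z)
      else 0)"
  by pat_completeness auto
termination
proof (relation "measure (\<lambda>(P, x, y). card {z \<in> P. z < y})", simp)
  fix P :: "'b::order set" and x y z :: 'b
  assume P: "finite P \<and> x \<in> P \<and> y \<in> P \<and> x \<le> y" and z: "z \<in> {z \<in> P. x \<le> z \<and> z < y}"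
  have "{w \<in> P. w < z} \<subset> {w \<in> P. w < y}"
    using z by (auto intro: less_trans)
  then show "((P, x, z), P, x, y) \<in> measure (\<lambda>(P, x, y). card {z \<in> P. z < y})"
    using P by (auto intro: psubset_card_mono)
qed

declare poset_mobius.simps [simp del]

end

theory Submission
  imports Defs
begin

text \<open>For fixed \<open>x\<close> in the ring, s_N is by definition the sum of c_M over all M
  above N in the finite poset P of normal members of D, so the formula is Moebius inversion from
  above on P. Inserting the definition of s into the right-hand side and exchanging the sums gives
  each c_M the weight "sum of mu(N,K) over the interval from N to M". That weight is 1 if M = N and
  0 otherwise (\<open>sum_poset_mobius\<close>), so only c_N survives
  (\<open>poset_mobius_inversion\<close>). Each family is then an explicit function of the
  other.\<close>

text \<open>Splitting the top element off the closed interval leaves the very sum whose negative is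
  the recursive value of mu(x,y) when x < y.\<close>

lemma sum_poset_mobius:
  assumes "finite P" "x \<in> P" "y \<in> P" "x \<le> y"
  shows "(\<Sum>z\<in>{z \<in> P. x \<le> z \<and> z \<le> y}. poset_mobius P x z) = (if x = y then 1 else 0)"
proof -
  have "{z \<in> P. x \<le> z \<and> z \<le> y} = insert y {z \<in> P. x \<le> z \<and> z < y}"
    using assms by (auto simp: order.order_iff_strict)
  then have "(\<Sum>z\<in>{z \<in> P. x \<le> z \<and> z \<le> y}. poset_mobius P x z) =
      poset_mobius P x y + (\<Sum>z\<in>{z \<in> P. x \<le> z \<and> z < y}. poset_mobius P x z)"
    using assms(1) by simp
  \<comment> \<open>On the diagonal the recursion returns 1 instead of a negated sum, but there the
    half-open interval is empty.\<close>
  moreover have "(\<Sum>z\<in>{z \<in> P. x \<le> z \<and> z < y}. poset_mobius P x z) = 0" if "x = y"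
    using that by (intro sum.neutral) auto
  ultimately show ?thesis
    using assms by (simp add: poset_mobius.simps[of P x y])
qed

lemma poset_mobius_inversion:
  fixes c :: "'b::order \<Rightarrow> int"
  assumes "finite P" "x \<in> P"
  shows "(\<Sum>y\<in>{y \<in> P. x \<le> y}. poset_mobius P x y * (\<Sum>z\<in>{z \<in> P. y \<le> z}. c z)) = c x"
proof -
  \<comment> \<open>By transitivity the inner index \<open>z\<close> also lies above
    \<open>x\<close>. Recording this makes both indices range over the same fixed set, linked only
    by \<open>y \<le> z\<close>, which is the form that \<open>sum.swap_restrict\<close>
    exchanges.\<close>
  have "(\<Sum>y\<in>{y \<in> P. x \<le> y}. poset_mobius P x y * (\<Sum>z\<in>{z \<in> P. y \<le> z}. c z)) =
      (\<Sum>y\<in>{y \<in> P. x \<le> y}. \<Sum>z\<in>{z \<in> {z \<in> P. x \<le> z}. y \<le> z}. poset_mobius P x y * c z)"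
    unfolding sum_distrib_left by (intro sum.cong) auto
  also have "\<dots> =
      (\<Sum>z\<in>{z \<in> P. x \<le> z}. \<Sum>y\<in>{y \<in> {y \<in> P. x \<le> y}. y \<le> z}. poset_mobius P x y * c z)"
    using assms(1) by (intro sum.swap_restrict) auto
  also have "\<dots> = (\<Sum>z\<in>{z \<in> P. x \<le> z}. (if x = z then 1 else 0) * c z)"
  proof (intro sum.cong refl)
    fix z assume "z \<in> {z \<in> P. x \<le> z}"
    then show "(\<Sum>y\<in>{y \<in> {y \<in> P. x \<le> y}. y \<le> z}. poset_mobius P x y * c z) =
        (if x = z then 1 else 0) * c z"
      using sum_poset_mobius[OF assms, of z] by (simp add: conj_assoc flip: sum_distrib_right)
  qed
  also have "\<dots> = c x"
    using assms sum.delta'[of "{z \<in> P. x \<le> z}" x c]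
    by (simp add: if_distribR if_distrib[of "\<lambda>t. t * _"] cong: if_cong)
  finally show ?thesis .
qed

lemma finite_subgroup_collection:
  assumes "finite (carrier G)" "subgroup_collection G D"
  shows "finite D"
proof (rule finite_subset)
  show "D \<subseteq> Pow (carrier G)"
    using assms(2) by (auto simp: subgroup_collection_def dest: subgroup.subset)
qed (use assms(1) in simp)

theorem proposition3p6:
  fixes G :: "('a, 'm) monoid_scheme" and D :: "'a set set"
  assumes "group G" and "finite (carrier G)" and "subgroup_collection G D"
  shows "(\<forall>x\<in>carrier (partial_burnside_ring G D). \<forall>N\<in>D \<inter> normal_subgroups G.
            core_coeff G D x N =
              (\<Sum>M\<in>{M \<in> D \<inter> normal_subgroups G. N \<subseteq> M}.
                 poset_mobius (D \<inter> normal_subgroups G) N M * cumulative_core_coeff G D x M)) \<and>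
         (\<forall>x\<in>carrier (partial_burnside_ring G D). \<forall>y\<in>carrier (partial_burnside_ring G D).
            (\<forall>N\<in>D \<inter> normal_subgroups G. core_coeff G D x N = core_coeff G D y N) \<longleftrightarrow>
            (\<forall>N\<in>D \<inter> normal_subgroups G.
               cumulative_core_coeff G D x N = cumulative_core_coeff G D y N))"
proof -
  let ?P = "D \<inter> normal_subgroups G"
  have "finite ?P"
    using finite_subgroup_collection[OF assms(2,3)] by simp
  \<comment> \<open>Inclusion is the order on sets, so the abstract inversion applies with
    \<open>core_coeff G D x\<close> as the function \<open>c\<close>.\<close>
  then have inversion: "core_coeff G D x N =
      (\<Sum>M\<in>{M \<in> ?P. N \<subseteq> M}. poset_mobius ?P N M * cumulative_core_coeff G D x M)"
    if "N \<in> ?P" for x N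
    unfolding cumulative_core_coeff_def using poset_mobius_inversion[OF _ that, symmetric] by simp
  \<comment> \<open>This direction of the equivalence needs inversion: both coefficients become sums
    with the same Moebius weights over members of \<open>?P\<close>, where the cumulative values
    agree. The converse reads off the definition of s.\<close>
  have "core_coeff G D x N = core_coeff G D y N"
    if "\<forall>M\<in>?P. cumulative_core_coeff G D x M = cumulative_core_coeff G D y M" "N \<in> ?P" for x y N
    unfolding inversion[OF that(2)] using that(1) by (intro sum.cong) auto
  moreover have "cumulative_core_coeff G D x N = cumulative_core_coeff G D y N"
    if "\<forall>M\<in>?P. core_coeff G D x M = core_coeff G D y M" for x y N
    unfolding cumulative_core_coeff_def using that by (intro sum.cong) auto
  ultimately show ?thesis
    using inversion by blast
qed

end
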